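(* For every net of conics $\mathcal{L}\subset\mathbb{S}^3$ of type $A$, the ML-base locus $\mathbb{P}\mathcal{L}^{-1}\cap\mathbb{P}\mathcal{L}^\perp$ is empty and the ML-degree of $\mathcal{L}$ is $4$.
   Context: Everything is over $\mathbb{C}$. $\mathbb{S}^3$ is the $6$-dimensional space of complex symmetric $3\times 3$ matrices, $\mathbb{P}^5=\mathbb{P}\mathbb{S}^3$. A net of conics is a $3$-dimensional linear subspace of $\mathbb{S}^3$. For a net $\mathcal{L}$ containing an invertible matrix, $\mathbb{P}\mathcal{L}^{-1}\subset\mathbb{P}^5$ is the Zariski closure of $\mathbb{P}(\{A^{-1} \mid A\in\mathcal{L},\ \det A\neq 0\})$. The polar net is $\mathcal{L}^\perp=\{N\in\mathbb{S}^3\mid \mathrm{trace}(MN)=0 \text{ for all } M\in\mathcal{L}\}$. The ML-base locus of $\mathcal{L}$ is $\mathbb{P}\mathcal{L}^{-1}\cap\mathbb{P}\mathcal{L}^\perp$. The ML-degree of $\mathcal{L}$ is the number of complex critical points on $\mathcal{L}$ of $\ell_S(M)=\log\det(M)-\mathrm{trace}(SM)$ for a generic matrix $S\in\mathbb{S}^3$; that is, the number of invertible $M\in\mathcal{L}$ with $\mathrm{trace}(M^{-1}N)=\mathrm{trace}(SN)$ for all $N\in\mathcal{L}$. A symmetric matrix $M$ is identified with the quadratic form $(x,y,z)M(x,y,z)^T$; e.g. $2xz$ is the matrix with entries $1$ at positions $(1,3),(3,1)$ and $0$ elsewhere. Two nets are congruent if $\mathcal{L}_2=g^T\mathcal{L}_1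 g$ for some $g\in \mathrm{GL}(3,\mathbb{C})$. A net is of type $A$ if it is congruent to the net spanned by $y^2+2xz,\ 2yz,\ -x^2-2gy^2+cz^2+2gxz$ for some constants $c,g\in\mathbb{C}$ with $c\neq 0$, $c\neq -9g^2$. *)

theory Defs
  imports "HOL-Analysis.Analysis" "HOL-Computational_Algebra.Polynomial"
begin

type_synonym cmat = "complex ^ 3 ^ 3"

(* The library only provides real scaling of matrices; this is complex scaling. *)
definition cscale :: "complex \<Rightarrow> cmat \<Rightarrow> cmat" where
  "cscale c A = (\<chi> i j. c * A $ i $ j)"

interpretation cmat: vector_space cscale
  by unfold_locales (simp_all add: cscale_def vec_eq_iff algebra_simps)

definition Sym3 :: "cmat set" where
  "Sym3 = {A. transpose A = A}"

definition net_of_conics :: "cmat set \<Rightarrow> bool" where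
  "net_of_conics L \<longleftrightarrow> L \<subseteq> Sym3 \<and> cmat.subspace L \<and> cmat.dim L = 3"

(* A point of P(Sym3) is a one-dimensional linear subspace of Sym3. *)
definition proj :: "cmat set \<Rightarrow> cmat set set" where
  "proj X = {cmat.span {A} | A. A \<in> X \<and> A \<noteq> 0}"

abbreviation P5 :: "cmat set set" where
  "P5 \<equiv> proj Sym3"

(* Homogeneous polynomials of degree d in the matrix entries, as functions.  On Sym3 the
   entries (i,j) and (j,i) agree, so these are the forms in the six coordinates. *)
inductive homogeneous_poly :: "nat \<Rightarrow> (cmat \<Rightarrow> complex) \<Rightarrow> bool" where
  hom_const: "homogeneous_poly 0 (\<lambda>A. c)"
| hom_entry: "homogeneous_poly 1 (\<lambda>A. A $ i $ j)"
| hom_add: "homogeneous_poly d p \<Longrightarrow> homogeneous_poly d q \<Longrightarrow> homogeneous_poly d (\<lambda>A. p A + q A)"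
| hom_mult: "homogeneous_poly d p \<Longrightarrow> homogeneous_poly e q \<Longrightarrow> homogeneous_poly (d + e) (\<lambda>A. p A * q A)"

definition zariski_closed :: "cmat set set \<Rightarrow> bool" where
  "zariski_closed Z \<longleftrightarrow>
     (\<exists>F. (\<forall>p\<in>F. \<exists>d. homogeneous_poly d p) \<and> Z = {P \<in> P5. \<forall>p\<in>F. \<forall>A\<in>P. p A = 0})"

definition zariski_closure :: "cmat set set \<Rightarrow> cmat set set" where
  "zariski_closure X = zariski_closed hull X"

definition proj_reciprocal :: "cmat set \<Rightarrow> cmat set set" where
  "proj_reciprocal L = zariski_closure (proj {matrix_inv A | A. A \<in> L \<and> det A \<noteq> 0})"

definition polar_net :: "cmat set \<Rightarrow> cmat set" where
  "polar_net L = {N \<in> Sym3. \<forall>M\<in>L. trace (M ** N) = 0}"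

definition ml_base_locus :: "cmat set \<Rightarrow> cmat set set" where
  "ml_base_locus L = proj_reciprocal L \<inter> proj (polar_net L)"

inductive polynomial_fun :: "(cmat \<Rightarrow> complex) \<Rightarrow> bool" where
  polyfun_const: "polynomial_fun (\<lambda>A. c)"
| polyfun_entry: "polynomial_fun (\<lambda>A. A $ i $ j)"
| polyfun_add: "polynomial_fun p \<Longrightarrow> polynomial_fun q \<Longrightarrow> polynomial_fun (\<lambda>A. p A + q A)"
| polyfun_mult: "polynomial_fun p \<Longrightarrow> polynomial_fun q \<Longrightarrow> polynomial_fun (\<lambda>A. p A * q A)"

(* A property holds for generic S in Sym3 if it holds on a nonempty Zariski open subset of the
   affine space Sym3, equivalently off the zero set of a polynomial not vanishing identically
   on Sym3. *)
definition for_generic :: "(cmat \<Rightarrow> bool) \<Rightarrow> bool" where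
  "for_generic Q \<longleftrightarrow>
     (\<exists>p. polynomial_fun p \<and> (\<exists>S\<in>Sym3. p S \<noteq> 0) \<and> (\<forall>S\<in>Sym3. p S \<noteq> 0 \<longrightarrow> Q S))"

(* Critical points of log (det M) - trace (S M) on L: the differential of log det at M in
   direction N is trace (M^{-1} N). *)
definition critical_points :: "cmat set \<Rightarrow> cmat \<Rightarrow> cmat set" where
  "critical_points L S =
     {M \<in> L. invertible M \<and> (\<forall>N\<in>L. trace (matrix_inv M ** N) = trace (S ** N))}"

(* A relation rather than a function, so that asserting a value also asserts that the generic
   number of critical points exists and is finite; has_ml_degree_unique shows that the value
   is determined by L. *)
definition has_ml_degree :: "cmat set \<Rightarrow> nat \<Rightarrow> bool" where
  "has_ml_degree L n \<longleftrightarrow>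
     for_generic (\<lambda>S. finite (critical_points L S) \<and> card (critical_points L S) = n)"

lemma polynomial_fun_on_line:
  assumes "polynomial_fun p"
  shows "\<exists>q. \<forall>t. p (A + cscale t B) = poly q t"
  using assms
proof induction
  case (polyfun_const c)
  show ?case by (rule exI[of _ "[:c:]"]) simp
next
  case (polyfun_entry i j)
  show ?case by (rule exI[of _ "[:A $ i $ j, B $ i $ j:]"]) (simp add: cscale_def)
next
  case (polyfun_add p q)
  then show ?case by (metis poly_add)
next
  case (polyfun_mult p q)
  then show ?case by (metis poly_mult)
qed

lemma for_generic_conj:
  assumes "for_generic P" "for_generic Q"
  shows "\<exists>S\<in>Sym3. P S \<and> Q S"
proof -
  obtain p S where p: "polynomial_fun p" "S \<in> Sym3" "p S \<noteq> 0" "\<forall>S\<in>Sym3. p S \<noteq> 0 \<longrightarrow> P S"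
    using assms(1) by (auto simp: for_generic_def)
  obtain q T where q: "polynomial_fun q" "T \<in> Sym3" "q T \<noteq> 0" "\<forall>S\<in>Sym3. q S \<noteq> 0 \<longrightarrow> Q S"
    using assms(2) by (auto simp: for_generic_def)
  define U where "U t = S + cscale t (T - S)" for t
  obtain a where a: "\<And>t. p (U t) = poly a t"
    using polynomial_fun_on_line[OF p(1)] unfolding U_def by metis
  obtain b where b: "\<And>t. q (U t) = poly b t"
    using polynomial_fun_on_line[OF q(1)] unfolding U_def by metis
  have U0: "U 0 = S" and U1: "U 1 = T"
    by (simp_all add: U_def cscale_def vec_eq_iff)
  have "a \<noteq> 0" using a[of 0] p(3) U0 by auto
  moreover have "b \<noteq> 0" using b[of 1] q(3) U1 by auto
  ultimately have "a * b \<noteq> 0" by simp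
  then obtain t where "poly (a * b) t \<noteq> 0"
    using poly_all_0_iff_0 by blast
  then have "p (U t) \<noteq> 0" "q (U t) \<noteq> 0" using a b by auto
  moreover have "U t \<in> Sym3"
    using p(2) q(2) by (simp add: Sym3_def U_def cscale_def transpose_def vec_eq_iff)
  ultimately show ?thesis using p(4) q(4) by blast
qed

lemma has_ml_degree_unique: "has_ml_degree L m \<Longrightarrow> has_ml_degree L n \<Longrightarrow> m = n"
  unfolding has_ml_degree_def by (drule (1) for_generic_conj) auto

definition congruent_nets :: "cmat set \<Rightarrow> cmat set \<Rightarrow> bool" where
  "congruent_nets L1 L2 \<longleftrightarrow>
     (\<exists>g::cmat. invertible g \<and> L2 = (\<lambda>M. transpose g ** M ** g) ` L1)"

definition conic :: "complex \<Rightarrow> complex \<Rightarrow> complex \<Rightarrow> complex \<Rightarrow> complex \<Rightarrow> complex \<Rightarrow> cmat" where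
  "conic a b c d e f = vector [vector [a, d, e], vector [d, b, f], vector [e, f, c]]"

lemma conic_quadratic_form:
  fixes x y z :: complex
  defines "v \<equiv> vector [x, y, z] :: complex ^ 3"
  shows "(\<Sum>i\<in>UNIV. v $ i * (conic a b c d e f *v v) $ i) =
    a * x\<^sup>2 + b * y\<^sup>2 + c * z\<^sup>2 + 2 * d * x * y + 2 * e * x * z + 2 * f * y * z"
  by (simp add: v_def conic_def matrix_vector_mult_def sum_3 vector_3 power2_eq_square algebra_simps)

(* Spanned by y^2 + 2xz, 2yz and -x^2 - 2g y^2 + c z^2 + 2g xz; see conic_quadratic_form. *)
definition type_A_normal_form :: "complex \<Rightarrow> complex \<Rightarrow> cmat set" where
  "type_A_normal_form c g =
     cmat.span {conic 0 1 0 0 1 0, conic 0 0 0 0 0 1, conic (-1) (- 2 * g) c 0 g 0}"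

definition type_A :: "cmat set \<Rightarrow> bool" where
  "type_A L \<longleftrightarrow>
     (\<exists>c g. c \<noteq> 0 \<and> c \<noteq> - 9 * g\<^sup>2 \<and> congruent_nets (type_A_normal_form c g) L)"

end

(* Up to congruence, put q = a - 2 g t, k = 3 g and e = c + k^2, where a, b, t are the coordinates in
   the given basis. The determinant of the net becomes the cubic t b^2 - q (q^2 + 2 k q t + e t^2),
   which is smooth exactly because c and e do not vanish.

   Critical points for S are the points at which the logarithmic gradient of this cubic is a
   prescribed vector (u, v, w), linear in S. Eliminating b and the scaling factor leaves a quartic
   in q / t, whose discriminant is nonzero for generic S; a resultant keeps the roots away from the
   cubic itself. So there are four critical points.

   The entries of the adjugate of a matrix in the net span all quadratic forms in (q, b, t). Hence
   the reciprocal variety is a Veronese surface, on which the principal 2 by 2 minors of the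
   matrix of monomials vanish. A common zero of these minors on the polar net would give a common
   zero of the three partial derivatives of the cubic, and there is none. *)

theory Submission
  imports Defs "HOL-Computational_Algebra.Fundamental_Theorem_Algebra"
begin

section \<open>Symmetric matrices of size three\<close>

lemma matrix_eq_3:
  fixes A B :: cmat
  shows "A = B \<longleftrightarrow>
    A$1$1 = B$1$1 \<and> A$1$2 = B$1$2 \<and> A$1$3 = B$1$3 \<and>
    A$2$1 = B$2$1 \<and> A$2$2 = B$2$2 \<and> A$2$3 = B$2$3 \<and>
    A$3$1 = B$3$1 \<and> A$3$2 = B$3$2 \<and> A$3$3 = B$3$3"
  by (simp add: vec_eq_iff forall_3)

lemma conic_nth [simp]:
  "conic a b c d e f $ 1 $ 1 = a" "conic a b c d e f $ 1 $ 2 = d" "conic a b c d e f $ 1 $ 3 = e"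
  "conic a b c d e f $ 2 $ 1 = d" "conic a b c d e f $ 2 $ 2 = b" "conic a b c d e f $ 2 $ 3 = f"
  "conic a b c d e f $ 3 $ 1 = e" "conic a b c d e f $ 3 $ 2 = f" "conic a b c d e f $ 3 $ 3 = c"
  by (simp_all add: conic_def vector_3)

lemma cscale_nth [simp]: "cscale c A $ i $ j = c * A $ i $ j"
  by (simp add: cscale_def)

lemma mult_nth_3:
  fixes A B :: cmat
  shows "(A ** B) $ i $ j = A $ i $ 1 * B $ 1 $ j + A $ i $ 2 * B $ 2 $ j + A $ i $ 3 * B $ 3 $ j"
  by (simp add: matrix_matrix_mult_def sum_3)

lemma trace_3:
  fixes A :: cmat
  shows "trace A = A $ 1 $ 1 + A $ 2 $ 2 + A $ 3 $ 3"
  by (simp add: trace_def sum_3)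

lemma Sym3_conic [simp]: "conic a b c d e f \<in> Sym3"
  by (simp add: Sym3_def transpose_def matrix_eq_3)

lemma Sym3_nth_commute:
  assumes "S \<in> Sym3"
  shows "S $ i $ j = S $ j $ i"
proof -
  have "transpose S $ j $ i = S $ j $ i" using assms by (simp add: Sym3_def)
  then show ?thesis by (simp add: transpose_def)
qed

lemma Sym3_eq_conic:
  assumes "S \<in> Sym3"
  shows "S = conic (S$1$1) (S$2$2) (S$3$3) (S$1$2) (S$1$3) (S$2$3)"
  unfolding matrix_eq_3 conic_nth
  using Sym3_nth_commute[OF assms, of 2 1] Sym3_nth_commute[OF assms, of 3 1]
    Sym3_nth_commute[OF assms, of 3 2] by blast

lemma Sym3_congruence:
  assumes "A \<in> Sym3"
  shows "g ** A ** transpose g \<in> Sym3"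
  using assms by (simp add: Sym3_def matrix_transpose_mul matrix_mul_assoc)

lemma matrix_mult_inv:
  fixes A :: cmat
  assumes "invertible A"
  shows "A ** matrix_inv A = mat 1" "matrix_inv A ** A = mat 1"
  using someI_ex[OF assms[unfolded invertible_def]] by (simp_all add: matrix_inv_def)

lemma invertible_mult_cancel:
  fixes g A B :: cmat
  assumes "invertible g"
  shows "g ** A = g ** B \<longleftrightarrow> A = B" "A ** g = B ** g \<longleftrightarrow> A = B"
proof -
  have "A = B" if "g ** A = g ** B"
  proof -
    have "(matrix_inv g ** g) ** A = (matrix_inv g ** g) ** B"
      unfolding matrix_mul_assoc[symmetric] that ..
    then show ?thesis by (simp add: matrix_mult_inv[OF assms])
  qed
  then show "g ** A = g ** B \<longleftrightarrow> A = B" by blast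
  have "A = B" if "A ** g = B ** g"
  proof -
    have "A ** (g ** matrix_inv g) = B ** (g ** matrix_inv g)"
      unfolding matrix_mul_assoc that ..
    then show ?thesis by (simp add: matrix_mult_inv[OF assms])
  qed
  then show "A ** g = B ** g \<longleftrightarrow> A = B" by blast
qed

lemma matrix_inv_eqI:
  fixes A B :: cmat
  assumes "A ** B = mat 1"
  shows "matrix_inv A = B"
proof -
  have inv: "invertible A" "B ** A = mat 1"
    using assms matrix_left_right_inverse[of A B] by (auto simp: invertible_def)
  then have "matrix_inv A ** (A ** B) = B"
    by (simp add: matrix_mul_assoc matrix_mult_inv)
  then show ?thesis using assms by simp
qed

section \<open>Congruence\<close>

lemma invertible_congruence_iff:
  fixes g A :: cmat
  assumes "invertible g"
  shows "invertible (transpose g ** A ** g) \<longleftrightarrow> invertible A"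
  using assms by (auto simp: invertible_det_nz det_mul)

lemma invertible_transpose:
  fixes g :: cmat
  shows "invertible g \<Longrightarrow> invertible (transpose g)"
  by (simp add: invertible_det_nz)

text \<open>Inverses transform contragrediently: if \<open>A\<close> is replaced by
  \<open>transpose g ** A ** g\<close>, its inverse moves by \<open>g\<close> the other way. The
  equation is solved for \<open>matrix_inv A\<close>, so that the inverse of \<open>g\<close> stays
  out of later statements.\<close>

lemma matrix_inv_congruence:
  fixes g A :: cmat
  assumes "invertible g" "invertible A"
  shows "g ** matrix_inv (transpose g ** A ** g) ** transpose g = matrix_inv A"
proof -
  note [simp] = matrix_mult_inv
  define h where "h = matrix_inv g"
  have h: "g ** h = mat 1" "transpose h ** transpose g = mat 1"
    using assms(1) by (simp_all add: h_def flip: matrix_transpose_mul)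
  then have h': "transpose g ** transpose h = mat 1"
    using matrix_left_right_inverse by blast
  have "(transpose g ** A ** g) ** (h ** matrix_inv A ** transpose h) =
      transpose g ** (A ** (g ** h) ** matrix_inv A) ** transpose h"
    by (simp only: matrix_mul_assoc)
  also have "\<dots> = mat 1" using assms by (simp add: h h')
  finally have "matrix_inv (transpose g ** A ** g) = h ** matrix_inv A ** transpose h"
    by (rule matrix_inv_eqI)
  then have "g ** matrix_inv (transpose g ** A ** g) ** transpose g =
      (g ** h) ** matrix_inv A ** (transpose h ** transpose g)"
    by (simp only: matrix_mul_assoc)
  then show ?thesis by (simp add: h)
qed

lemma trace_congruence:
  fixes g A B :: cmat
  shows "trace (B ** (transpose g ** A ** g)) = trace (g ** B ** transpose g ** A)"
proof -
  have "trace (B ** (transpose g ** A ** g)) = trace ((B ** transpose g ** A) ** g)"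
    by (simp add: matrix_mul_assoc)
  also have "\<dots> = trace (g ** (B ** transpose g ** A))" by (rule trace_mul_sym)
  finally show ?thesis by (simp add: matrix_mul_assoc)
qed

lemma homogeneous_poly_congruence:
  assumes "homogeneous_poly d p"
  shows "homogeneous_poly d (\<lambda>A. p (g ** A ** transpose g))"
  using assms
proof induction
  case (hom_entry i j)
  have scale: "homogeneous_poly 1 (\<lambda>A. c * A $ k $ l)" for c k l
  proof -
    have "homogeneous_poly (0 + 1) (\<lambda>A. c * A $ k $ l)"
      by (rule hom_mult[OF hom_const homogeneous_poly.hom_entry])
    then show ?thesis by (simp only: add_0_left)
  qed
  \<comment> \<open>The entry is expanded into nine scaled entries, each of degree literally 1,
    because \<open>hom_add\<close> asks for equal degrees.\<close>
  have "homogeneous_poly 1 (\<lambda>A. (g$i$1*g$j$1) * A$1$1 + (g$i$1*g$j$2) * A$1$2 + (g$i$1*g$j$3) * A$1$3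
     + (g$i$2*g$j$1) * A$2$1 + (g$i$2*g$j$2) * A$2$2 + (g$i$2*g$j$3) * A$2$3
     + (g$i$3*g$j$1) * A$3$1 + (g$i$3*g$j$2) * A$3$2 + (g$i$3*g$j$3) * A$3$3)"
    by (intro hom_add scale)
  then show ?case
    by (rule back_subst[of "homogeneous_poly 1"])
      (simp add: fun_eq_iff mult_nth_3 transpose_def algebra_simps)
qed (rule hom_add hom_mult, assumption, assumption | rule hom_const)+

lemma polynomial_fun_congruence:
  assumes "polynomial_fun p"
  shows "polynomial_fun (\<lambda>A. p (g ** A ** transpose g))"
  using assms
proof induction
  case (polyfun_entry i j)
  show ?case unfolding mult_nth_3 by (intro polynomial_fun.intros)
qed (rule polyfun_add polyfun_mult, assumption, assumption | rule polyfun_const)+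

text \<open>Congruence changes log det only by an additive constant, and cyclicity of the trace
  moves \<open>g\<close> from the net to the data matrix \<open>S\<close>.\<close>

lemma critical_points_congruence:
  fixes g :: cmat
  assumes g: "invertible g"
  shows "critical_points ((\<lambda>M. transpose g ** M ** g) ` L) S =
    (\<lambda>M. transpose g ** M ** g) ` critical_points L (g ** S ** transpose g)"
proof -
  have "invertible (transpose g ** M ** g) \<and>
      (\<forall>N\<in>L. trace (matrix_inv (transpose g ** M ** g) ** (transpose g ** N ** g)) =
        trace (S ** (transpose g ** N ** g))) \<longleftrightarrow>
    invertible M \<and> (\<forall>N\<in>L. trace (matrix_inv M ** N) = trace (g ** S ** transpose g ** N))" for M
    using g by (simp add: trace_congruence invertible_congruence_iff matrix_inv_congruence cong: conj_cong)
  then show ?thesis by (auto simp: critical_points_def)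
qed

section \<open>Quartics with simple roots and the fibres of the polar map\<close>

text \<open>In terms of the invariants \<open>I\<close> and \<open>J\<close> of a quartic, \<open>4 I^3 - J^2\<close> is 27 times its discriminant.\<close>

definition quartic_disc :: "complex \<Rightarrow> complex \<Rightarrow> complex \<Rightarrow> complex \<Rightarrow> complex \<Rightarrow> complex" where
  "quartic_disc a b c d f =
     4 * (12 * a * f - 3 * b * d + c^2)^3
     - (72 * a * c * f + 9 * b * c * d - 27 * a * d^2 - 27 * f * b^2 - 2 * c^3)^2"

text \<open>The two equations of a double root are linear in \<open>d\<close> and \<open>f\<close>.
  Solving for these turns the claim into a polynomial identity in \<open>a\<close>,
  \<open>b\<close>, \<open>c\<close>, \<open>x\<close>.\<close>

lemma quartic_disc_double_root:
  fixes a b c d f x :: complex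
  assumes "f + d * x + c * x^2 + b * x^3 + a * x^4 = 0"
    and "d + 2 * c * x + 3 * b * x^2 + 4 * a * x^3 = 0"
  shows "quartic_disc a b c d f = 0"
proof -
  have d: "d = - 2 * c * x - 3 * b * x^2 - 4 * a * x^3"
    using assms(2) by algebra
  have f: "f = c * x^2 + 2 * b * x^3 + 3 * a * x^4"
    using assms(1) unfolding d by algebra
  show ?thesis
    unfolding quartic_disc_def d f by algebra
qed

text \<open>Over the complex numbers a squarefree polynomial is a constant times the product of one
  linear factor per root; compare degrees.\<close>

lemma card_roots_rsquarefree:
  fixes p :: "complex poly"
  assumes "rsquarefree p"
  shows "card {x. poly p x = 0} = degree p"
proof -
  have "p \<noteq> 0" using assms by (auto simp: rsquarefree_def)
  then have fin: "finite {x. poly p x = 0}" by (rule poly_roots_finite)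
  have "degree p = degree (smult (lead_coeff p) (\<Prod>z | poly p z = 0. [:-z, 1:]))"
    using complex_poly_decompose_rsquarefree[OF assms] by simp
  also have "\<dots> = degree (\<Prod>z | poly p z = 0. [:-z, 1:])"
    using \<open>p \<noteq> 0\<close> by simp
  also have "\<dots> = card {x. poly p x = 0}"
    by (subst degree_prod_eq_sum_degree) (auto simp: fin)
  finally show ?thesis by simp
qed

lemma card_roots_quartic:
  fixes a b c d f :: complex
  assumes "a \<noteq> 0" "quartic_disc a b c d f \<noteq> 0"
  shows "finite {x. f + d * x + c * x^2 + b * x^3 + a * x^4 = 0}"
    and "card {x. f + d * x + c * x^2 + b * x^3 + a * x^4 = 0} = 4"
proof -
  define p where "p = [:f, d, c, b, a:]"
  have p: "poly p x = f + d * x + c * x^2 + b * x^3 + a * x^4" for x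
    by (simp add: p_def algebra_simps eval_nat_numeral)
  have p': "poly (pderiv p) x = d + 2 * c * x + 3 * b * x^2 + 4 * a * x^3" for x
    by (simp add: p_def pderiv_pCons algebra_simps eval_nat_numeral)
  have "rsquarefree p"
    unfolding rsquarefree_roots p p' using quartic_disc_double_root assms(2) by blast
  moreover have "degree p = 4" using assms(1) by (simp add: p_def)
  moreover from this have "p \<noteq> 0" by auto
  ultimately show "finite {x. f + d * x + c * x^2 + b * x^3 + a * x^4 = 0}"
    "card {x. f + d * x + c * x^2 + b * x^3 + a * x^4 = 0} = 4"
    using poly_roots_finite[of p] card_roots_rsquarefree[of p] by (simp_all add: p)
qed

text \<open>The Sylvester resultant of a x^2 + b x + c and a' x^2 + b' x + c', in Bezout
  form.\<close>

definition quadratic_resultant ::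
    "complex \<Rightarrow> complex \<Rightarrow> complex \<Rightarrow> complex \<Rightarrow> complex \<Rightarrow> complex \<Rightarrow> complex" where
  "quadratic_resultant a b c a' b' c' =
     (a * c' - a' * c)^2 - (a * b' - a' * b) * (b * c' - b' * c)"

text \<open>Eliminating x^2 gives one linear relation for the root; eliminating the constant terms
  and dividing by \<open>x\<close> gives another. Together they yield the resultant. For x = 0 both
  constant terms vanish.\<close>

lemma quadratic_resultant_common_root:
  assumes "a * x^2 + b * x + c = 0" "a' * x^2 + b' * x + c' = 0"
  shows "quadratic_resultant a b c a' b' c' = 0"
proof (cases "x = 0")
  case True
  then show ?thesis using assms by (simp add: quadratic_resultant_def)
next
  case False
  have 1: "(a * b' - a' * b) * x = - (a * c' - a' * c)"
    using assms by algebra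
  have "x * ((a * c' - a' * c) * x + (b * c' - b' * c)) = 0"
    using assms by algebra
  with False have "(a * c' - a' * c) * x + (b * c' - b' * c) = 0"
    by simp
  with 1 show ?thesis
    unfolding quadratic_resultant_def by algebra
qed

section \<open>The cubic of the net and its logarithmic gradient\<close>

definition cubic :: "complex \<Rightarrow> complex \<Rightarrow> complex \<Rightarrow> complex \<Rightarrow> complex \<Rightarrow> complex" where
  "cubic k e q b t = t * b^2 - q^3 - 2 * k * q^2 * t - e * q * t^2"

text \<open>The three left-hand sides are the partial derivatives of \<open>cubic\<close>, so these
  are the points where its logarithmic gradient is (u, v, w).\<close>

definition polar_fibre ::
    "complex \<Rightarrow> complex \<Rightarrow> complex \<Rightarrow> complex \<Rightarrow> complex \<Rightarrow> (complex \<times> complex \<times> complex) set" where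
  "polar_fibre k e u v w =
     {(q, b, t). cubic k e q b t \<noteq> 0 \<and>
        - 3 * q^2 - 4 * k * q * t - e * t^2 = u * cubic k e q b t \<and>
        2 * t * b = v * cubic k e q b t \<and>
        b^2 - 2 * k * q^2 - 2 * e * q * t = w * cubic k e q b t}"

text \<open>The quartic is \<open>v^2 h^2 + 4 u w h - 8 u^2 (k x^2 + e x)\<close> with \<open>x = q / t\<close> and
  \<open>h = 3 x^2 + 4 k x + e\<close>.\<close>

definition fibre_disc :: "complex \<Rightarrow> complex \<Rightarrow> complex \<Rightarrow> complex \<Rightarrow> complex \<Rightarrow> complex" where
  "fibre_disc k e u v w =
     quartic_disc (9 * v^2) (24 * k * v^2) ((16 * k^2 + 6 * e) * v^2 + 12 * u * w - 8 * k * u^2)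
       (8 * e * k * v^2 + 16 * k * u * w - 8 * e * u^2) (e^2 * v^2 + 4 * e * u * w)"

text \<open>A root of that quartic at which the cubic vanishes satisfies \<open>u x + v y + w = 0\<close> by Euler's
  identity, where \<open>y = b / t\<close>; eliminating \<open>y\<close> leaves the following two quadratics.\<close>

definition fibre_resultant :: "complex \<Rightarrow> complex \<Rightarrow> complex \<Rightarrow> complex \<Rightarrow> complex \<Rightarrow> complex" where
  "fibre_resultant k e u v w =
     quadratic_resultant (u^2 - 2 * k * v^2) (4 * u * w - 2 * e * v^2) (3 * w^2)
       (3 * v^2) (4 * k * v^2 - 2 * u^2) (e * v^2 - 2 * u * w)"

text \<open>On the line v = 1, w = 0 the discriminant is a polynomial in \<open>u\<close>. If its
  coefficient at u^4 vanishes, then 3 e = 4 k^2; the coefficient at u^8 is then a multiple of e^2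
  k^4, so its vanishing would force k = 0 and e = 0.\<close>

lemma fibre_disc_nonzero:
  assumes "e \<noteq> 0" "e \<noteq> k^2"
  shows "\<exists>u. fibre_disc k e u 1 0 \<noteq> 0"
proof (rule ccontr)
  assume *: "\<not> ?thesis"
  define c4 where "c4 = 12 * e^2 * (e - k^2) * (3 * e - 4 * k^2)^2"
  define c6 where "c6 = 540 * k * e^4 - 864 * k^3 * e^3 + 320 * k^5 * e^2"
  define c8 where "c8 = - (e^2 * (243 * e^2 - 360 * k^2 * e + 176 * k^4))"
  define P where "P = smult 995328 [:0, 0, 0, 0, c4, 0, c6, 0, c8, 0, 32 * k^3 * e^2:]"
  have "fibre_disc k e u 1 0 = 995328 * (c4 * u^4 + c6 * u^6 + c8 * u^8 + 32 * k^3 * e^2 * u^10)" for u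
    unfolding fibre_disc_def quartic_disc_def c4_def c6_def c8_def power_one mult_1_right mult_zero_right add_0_right
    by algebra
  also have "\<dots> u = poly P u" for u
    by (simp add: P_def algebra_simps eval_nat_numeral)
  finally have "P = 0" using * poly_all_0_iff_0[of P] by simp
  then have c: "c4 = 0" "c8 = 0" by (simp_all add: P_def)
  have "3 * e = 4 * k^2" using c(1) assms by (simp add: c4_def)
  moreover have "243 * e^2 - 360 * k^2 * e + 176 * k^4 = 0" using c(2) assms by (simp add: c8_def)
  ultimately have "k^4 = 0" by algebra
  with \<open>3 * e = 4 * k^2\<close> assms show False by simp
qed

text \<open>At u = 0, v = 1 the resultant is a quartic in \<open>w\<close> with leading coefficient
  81, whatever \<open>k\<close> and \<open>e\<close> are.\<close>

lemma fibre_resultant_nonzero: "\<exists>w. fibre_resultant k e 0 1 w \<noteq> 0"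
proof (rule ccontr)
  assume *: "\<not> ?thesis"
  define P where "P = [:4 * k^2 * e^2 - 16 * k^2 * e^2 + 12 * e^3, 0,
      36 * k * e + 12 * k * (6 * e - 8 * k^2), 0, 81:]"
  have "fibre_resultant k e 0 1 w = poly P w" for w
    unfolding fibre_resultant_def quadratic_resultant_def P_def
    by (simp add: algebra_simps eval_nat_numeral)
  then have "P = 0" using * poly_all_0_iff_0[of P] by simp
  then show False by (simp add: P_def)
qed

text \<open>The map \<open>\<phi>\<close> is a bijection from the roots of the quartic
  \<open>F\<close> onto the fibre, with inverse x = q / t.\<close>

lemma polar_fibre_card:
  assumes "e \<noteq> 0" "e \<noteq> k^2" and u: "u \<noteq> 0" and v: "v \<noteq> 0"
    and disc: "fibre_disc k e u v w \<noteq> 0" and res: "fibre_resultant k e u v w \<noteq> 0"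
  shows "finite (polar_fibre k e u v w)" "card (polar_fibre k e u v w) = 4"
proof -
  define h where "h x = 3 * x^2 + 4 * k * x + e" for x
  define F where "F x = v^2 * (h x)^2 + 4 * u * w * h x - 8 * u^2 * (k * x^2 + e * x)" for x
  \<comment> \<open>Eliminating the value of the cubic from the first two fibre equations gives 2 u
    b = - v t h(x), which determines y = b / t.\<close>
  define y where "y x = - (v * h x / (2 * u))" for x
  \<comment> \<open>By Euler's identity u q + v b + w t = 3 on the fibre, that is, t times
    \<open>\<sigma> x\<close> is 3. This fixes the scale 3 / \<open>\<sigma> x\<close> in
    \<open>\<phi>\<close>.\<close>
  define \<sigma> where "\<sigma> x = u * x + v * y x + w" for x
  define \<phi> where "\<phi> x = (3 / \<sigma> x * x, 3 / \<sigma> x * y x, 3 / \<sigma> x)" for x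
  have F: "F x = (e^2 * v^2 + 4 * e * u * w) + (8 * e * k * v^2 + 16 * k * u * w - 8 * e * u^2) * x
      + ((16 * k^2 + 6 * e) * v^2 + 12 * u * w - 8 * k * u^2) * x^2 + (24 * k * v^2) * x^3
      + (9 * v^2) * x^4" for x
    unfolding F_def h_def by algebra
  have roots: "finite {x. F x = 0}" "card {x. F x = 0} = 4"
    using card_roots_quartic[OF _ disc[unfolded fibre_disc_def]] v unfolding F by simp_all
  have y: "2 * u * y x = - (v * h x)" for x
    using u by (simp add: y_def)
  have inj: "x = x'" if "\<phi> x = \<phi> x'" "\<sigma> x \<noteq> 0" for x x'
    using that by (auto simp: \<phi>_def)
  have root: "\<sigma> x \<noteq> 0 \<and> \<phi> x \<in> polar_fibre k e u v w" if x: "F x = 0" for x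
  proof -
    \<comment> \<open>The gradient of the cubic at (x, 0, 1) is (- h x, 0, - 2 x (k x + e)). A
      common zero of \<open>F\<close> and \<open>h\<close> would make this a singular point, which e
      = 0 or e = k^2 alone would allow.\<close>
    have h0: "h x \<noteq> 0"
    proof
      assume h: "h x = 0"
      have "8 * u^2 * (x * (k * x + e)) = 0" using x h unfolding F_def by algebra
      then have "x * (k * x + e) = 0" using u by simp
      then have "x = 0 \<or> e = - (k * x)" by (auto simp: add_eq_0_iff)
      then show False
      proof
        assume "e = - (k * x)"
        with h have "3 * (x * (x + k)) = 0" unfolding h_def by algebra
        then have "x = 0 \<or> x = - k" by (simp add: eq_neg_iff_add_eq_0)
        with \<open>e = - (k * x)\<close> assms(1,2) show False by (auto simp: power2_eq_square)
      qed (use h \<open>e \<noteq> 0\<close> in \<open>simp add: h_def\<close>)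
    qed
    then have y0: "y x \<noteq> 0" using u v by (simp add: y_def)
    \<comment> \<open>The second and third fibre equations with the value of the cubic eliminated;
      modulo the definition of \<open>y\<close> this is the equation F x = 0.\<close>
    have t: "v * ((y x)^2 - 2 * k * x^2 - 2 * e * x) = w * (2 * y x)"
    proof -
      have "4 * u^2 * (v * ((y x)^2 - 2 * k * x^2 - 2 * e * x) - w * (2 * y x)) = v * F x"
        using y[of x] unfolding F_def by algebra
      then show ?thesis using x u by simp
    qed
    have \<sigma>: "\<sigma> x \<noteq> 0"
    proof
      assume "\<sigma> x = 0"
      then have s: "u * x + w = - v * y x" unfolding \<sigma>_def by algebra
      have "(3 * v^2) * x^2 + (4 * k * v^2 - 2 * u^2) * x + (e * v^2 - 2 * u * w) = 0"
        using s y[of x] unfolding h_def by algebra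
      moreover have "4 * u^2 * ((u^2 - 2 * k * v^2) * x^2 + (4 * u * w - 2 * e * v^2) * x + 3 * w^2) = v^2 * F x"
        using s y[of x] unfolding F_def by algebra
      then have "(u^2 - 2 * k * v^2) * x^2 + (4 * u * w - 2 * e * v^2) * x + 3 * w^2 = 0"
        using x u by simp
      ultimately show False
        using quadratic_resultant_common_root res unfolding fibre_resultant_def by blast
    qed
    define \<tau> where "\<tau> = 3 / \<sigma> x"
    have \<tau>: "\<tau> * \<sigma> x = 3" "\<tau> \<noteq> 0" using \<sigma> by (simp_all add: \<tau>_def)
    define C where "C = cubic k e (\<tau> * x) (\<tau> * y x) \<tau>"
    \<comment> \<open>Euler's identity again: at (x, y, 1) the partial derivatives of the cubic are
      proportional to (u, v, w), with factor 2 y / v.\<close>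
    have "3 * (v * C) = \<tau>^3 * (2 * y x * \<sigma> x)"
      using t y[of x] unfolding C_def cubic_def \<sigma>_def h_def by algebra
    also have "\<dots> = 2 * \<tau>^2 * y x * (\<tau> * \<sigma> x)"
      by algebra
    also have "\<dots> = 3 * (2 * \<tau>^2 * y x)"
      by (simp add: \<tau>(1))
    finally have C: "v * C = 2 * \<tau>^2 * y x" by (simp only: mult_cancel_left) simp
    then have C0: "C \<noteq> 0" using \<tau>(2) y0 by auto
    have "v * (- 3 * (\<tau> * x)^2 - 4 * k * (\<tau> * x) * \<tau> - e * \<tau>^2) = v * (u * C)"
      using C y[of x] unfolding h_def by algebra
    moreover have "v * ((\<tau> * y x)^2 - 2 * k * (\<tau> * x)^2 - 2 * e * (\<tau> * x) * \<tau>) = v * (w * C)"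
      using C t by algebra
    moreover have "2 * \<tau> * (\<tau> * y x) = v * C"
      using C by algebra
    ultimately have "(\<tau> * x, \<tau> * y x, \<tau>) \<in> polar_fibre k e u v w"
      using v C0 by (simp add: polar_fibre_def C_def)
    then show ?thesis using \<sigma> by (simp add: \<phi>_def \<tau>_def)
  qed
  have sub: "\<exists>x. F x = 0 \<and> m = \<phi> x" if m: "m \<in> polar_fibre k e u v w" for m
  proof -
    obtain q b t where qbt: "m = (q, b, t)" by (cases m)
    define C where "C = cubic k e q b t"
    have C: "C \<noteq> 0" "- 3 * q^2 - 4 * k * q * t - e * t^2 = u * C" "2 * t * b = v * C"
      "b^2 - 2 * k * q^2 - 2 * e * q * t = w * C"
      using m by (simp_all add: polar_fibre_def qbt C_def)
    then have t: "t \<noteq> 0" using v by auto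
    define x where "x = q / t"
    have q: "q = t * x" using t by (simp add: x_def)
    have "t * (2 * u * b + v * t * h x) = 0"
      using C(2,3) unfolding h_def q by algebra
    then have "2 * u * b + v * t * h x = 0" using t by simp
    then have "2 * u * (b - t * y x) = 0" using y[of x] by algebra
    then have b: "b = t * y x" using u by simp
    \<comment> \<open>Euler's identity for the cubic, with its partial derivatives replaced by
      \<open>u * C\<close>, \<open>v * C\<close>, \<open>w * C\<close>.\<close>
    have "C * (u * q + v * b + w * t) = 3 * C"
      using C(2-4) unfolding C_def cubic_def by algebra
    then have "C * (t * \<sigma> x) = C * 3" unfolding \<sigma>_def q b by algebra
    then have "t * \<sigma> x = 3" using C(1) by simp
    then have "t = 3 / \<sigma> x" by (auto simp: eq_divide_eq)
    then have "m = \<phi> x" by (simp add: \<phi>_def qbt q b)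
    have "t^2 * (v * ((y x)^2 - 2 * k * x^2 - 2 * e * x) - w * (2 * y x)) = 0"
      using C(3,4) unfolding q b by algebra
    then have "v * ((y x)^2 - 2 * k * x^2 - 2 * e * x) - w * (2 * y x) = 0" using t by simp
    moreover have "4 * u^2 * (v * ((y x)^2 - 2 * k * x^2 - 2 * e * x) - w * (2 * y x)) = v * F x"
      using y[of x] unfolding F_def by algebra
    ultimately have "F x = 0" using v by simp
    with \<open>m = \<phi> x\<close> show ?thesis by blast
  qed
  have "polar_fibre k e u v w = \<phi> ` {x. F x = 0}"
    using root sub by blast
  moreover have "inj_on \<phi> {x. F x = 0}"
    using root inj by (auto simp: inj_on_def)
  ultimately show "finite (polar_fibre k e u v w)" "card (polar_fibre k e u v w) = 4"
    using roots by (simp_all add: card_image)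
qed

section \<open>Genericity\<close>

lemma for_generic_nonzero:
  assumes "polynomial_fun p" "S \<in> Sym3" "p S \<noteq> 0"
  shows "for_generic (\<lambda>S. p S \<noteq> 0)"
  using assms unfolding for_generic_def by blast

text \<open>The product of the two witness polynomials serves: \<open>for_generic_conj\<close>
  supplies a symmetric matrix at which neither factor vanishes.\<close>

lemma for_generic_both:
  assumes "for_generic P" "for_generic Q"
  shows "for_generic (\<lambda>S. P S \<and> Q S)"
proof -
  obtain p S where p: "polynomial_fun p" "S \<in> Sym3" "p S \<noteq> 0" "\<forall>S\<in>Sym3. p S \<noteq> 0 \<longrightarrow> P S"
    using assms(1) by (auto simp: for_generic_def)
  obtain q T where q: "polynomial_fun q" "T \<in> Sym3" "q T \<noteq> 0" "\<forall>S\<in>Sym3. q S \<noteq> 0 \<longrightarrow> Q S"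
    using assms(2) by (auto simp: for_generic_def)
  obtain U where "U \<in> Sym3" "p U \<noteq> 0" "q U \<noteq> 0"
    using for_generic_conj[OF for_generic_nonzero[OF p(1-3)] for_generic_nonzero[OF q(1-3)]] by blast
  then show ?thesis
    using p(4) q(4) polyfun_mult[OF p(1) q(1)] unfolding for_generic_def
    by (intro exI[of _ "\<lambda>A. p A * q A"]) auto
qed

lemma for_generic_mono:
  assumes "for_generic P" "\<And>S. S \<in> Sym3 \<Longrightarrow> P S \<Longrightarrow> Q S"
  shows "for_generic Q"
  using assms unfolding for_generic_def by blast

text \<open>The congruence is a linear automorphism of \<open>Sym3\<close>; a point where the pulled
  back polynomial is nonzero comes from applying the inverse congruence to the old one.\<close>

lemma for_generic_congruence:
  assumes g: "invertible g" and P: "for_generic P"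
  shows "for_generic (\<lambda>S. P (g ** S ** transpose g))"
proof -
  obtain p S where p: "polynomial_fun p" "S \<in> Sym3" "p S \<noteq> 0" "\<forall>S\<in>Sym3. p S \<noteq> 0 \<longrightarrow> P S"
    using P by (auto simp: for_generic_def)
  define h where "h = matrix_inv g"
  have h: "g ** h = mat 1" "transpose h ** transpose g = mat 1"
    using matrix_mult_inv(1)[OF g] by (simp_all add: h_def flip: matrix_transpose_mul)
  have "g ** (h ** S ** transpose h) ** transpose g = (g ** h) ** S ** (transpose h ** transpose g)"
    by (simp only: matrix_mul_assoc)
  then have "p (g ** (h ** S ** transpose h) ** transpose g) \<noteq> 0"
    using p(3) by (simp add: h)
  moreover have "h ** S ** transpose h \<in> Sym3"
    using p(2) by (rule Sym3_congruence)
  ultimately show ?thesis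
    using polynomial_fun_congruence[OF p(1), of g] p(4) Sym3_congruence
    unfolding for_generic_def by blast
qed

lemma polynomial_fun_diff:
  assumes "polynomial_fun p" "polynomial_fun q"
  shows "polynomial_fun (\<lambda>A. p A - q A)"
  using polyfun_add[OF assms(1) polyfun_mult[OF polyfun_const[of "-1"] assms(2)]] by simp

lemma polynomial_fun_power:
  assumes "polynomial_fun p"
  shows "polynomial_fun (\<lambda>A. p A ^ n)"
proof (induction n)
  case 0
  show ?case using polyfun_const[of 1] by simp
next
  case (Suc n)
  then show ?case using polyfun_mult[OF assms] by simp
qed

lemmas polynomial_fun_intros =
  polyfun_const polyfun_entry polyfun_add polyfun_mult polynomial_fun_diff polynomial_fun_power

section \<open>The ML-base locus\<close>

lemma homogeneous_poly_scale:
  assumes "homogeneous_poly d p"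
  shows "p (cscale t A) = t ^ d * p A"
  using assms by induction (simp_all add: algebra_simps power_add)

lemma homogeneous_poly_cmult:
  assumes "homogeneous_poly d p"
  shows "homogeneous_poly d (\<lambda>A. c * p A)"
proof -
  have "homogeneous_poly (0 + d) (\<lambda>A. c * p A)"
    by (rule hom_mult[OF hom_const assms])
  then show ?thesis by simp
qed

lemma homogeneous_poly_diff:
  assumes "homogeneous_poly d p" "homogeneous_poly d q"
  shows "homogeneous_poly d (\<lambda>A. p A - q A)"
  using hom_add[OF assms(1) homogeneous_poly_cmult[OF assms(2), of "-1"]] by simp

lemma matrix_inv_Sym3:
  assumes "A \<in> Sym3" "invertible A"
  shows "matrix_inv A \<in> Sym3"
proof -
  have "transpose (matrix_inv A ** A) = A ** transpose (matrix_inv A)"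
    using assms(1) by (simp add: matrix_transpose_mul Sym3_def)
  then have "matrix_inv A = transpose (matrix_inv A)"
    using assms(2) by (intro matrix_inv_eqI) (simp add: matrix_mult_inv)
  then show ?thesis by (simp add: Sym3_def)
qed

text \<open>The closure need not be computed. Any forms \<open>F\<close> vanishing on the inverses
  bound it from above, and it suffices that they have no common nonzero zero on the polar
  net.\<close>

lemma ml_base_locus_eq_empty:
  assumes L: "L \<subseteq> Sym3"
    and hom: "\<And>p. p \<in> F \<Longrightarrow> \<exists>d. homogeneous_poly d p"
    and inv: "\<And>M p. M \<in> L \<Longrightarrow> det M \<noteq> 0 \<Longrightarrow> p \<in> F \<Longrightarrow> p (matrix_inv M) = 0"
    and polar: "\<And>N. N \<in> polar_net L \<Longrightarrow> (\<And>p. p \<in> F \<Longrightarrow> p N = 0) \<Longrightarrow> N = 0"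
  shows "ml_base_locus L = {}"
proof -
  define Z where "Z = {P \<in> P5. \<forall>p\<in>F. \<forall>A\<in>P. p A = 0}"
  have "zariski_closed Z"
    using hom unfolding zariski_closed_def Z_def by blast
  moreover have "proj {matrix_inv A | A. A \<in> L \<and> det A \<noteq> 0} \<subseteq> Z"
  proof
    fix P assume "P \<in> proj {matrix_inv A | A. A \<in> L \<and> det A \<noteq> 0}"
    then obtain A where A: "A \<in> L" "det A \<noteq> 0" "matrix_inv A \<noteq> 0" "P = cmat.span {matrix_inv A}"
      by (auto simp: proj_def)
    have "matrix_inv A \<in> Sym3"
      using A L by (auto intro: matrix_inv_Sym3 simp: invertible_det_nz)
    then have "P \<in> P5" using A by (auto simp: proj_def)
    moreover have "p B = 0" if "p \<in> F" "B \<in> P" for p B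
    proof -
      have "B \<in> range (\<lambda>t. cscale t (matrix_inv A))"
        using that A(4) by (simp add: cmat.span_singleton)
      then obtain t where "B = cscale t (matrix_inv A)" by blast
      moreover obtain d where "homogeneous_poly d p"
        using hom \<open>p \<in> F\<close> by blast
      ultimately show ?thesis
        using inv[OF A(1,2) \<open>p \<in> F\<close>] by (simp add: homogeneous_poly_scale)
    qed
    ultimately show "P \<in> Z" by (simp add: Z_def)
  qed
  ultimately have "proj_reciprocal L \<subseteq> Z"
    unfolding proj_reciprocal_def zariski_closure_def by (intro hull_minimal)
  moreover have "P \<notin> Z" if P: "P \<in> proj (polar_net L)" for P
  proof
    assume "P \<in> Z"
    obtain N where N: "N \<in> polar_net L" "N \<noteq> 0" "P = cmat.span {N}"
      using P by (auto simp: proj_def)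
    have "N \<in> P" using N(3) by (simp add: cmat.span_base)
    then have "p N = 0" if "p \<in> F" for p using \<open>P \<in> Z\<close> that by (simp add: Z_def)
    with polar N show False by blast
  qed
  ultimately show ?thesis unfolding ml_base_locus_def by blast
qed

section \<open>The normal form\<close>

text \<open>With coordinates a, b, t in the spanning conics, the entries at (2,2) and (1,3) are a -
  2 g t and a + g t. Taking the former as \<open>q\<close> makes the latter q + k t with k = 3
  g.\<close>

definition normal_mat :: "complex \<Rightarrow> complex \<Rightarrow> complex \<Rightarrow> complex \<Rightarrow> complex \<Rightarrow> cmat" where
  "normal_mat c k q b t = conic (- t) q (c * t) 0 (q + k * t) b"

definition normal_adj :: "complex \<Rightarrow> complex \<Rightarrow> complex \<Rightarrow> complex \<Rightarrow> complex \<Rightarrow> cmat" where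
  "normal_adj c k q b t =
     conic (c * q * t - b^2) (- c * t^2 - (q + k * t)^2) (- (q * t))
       (b * (q + k * t)) (- (q * (q + k * t))) (t * b)"

lemma span_3:
  "cmat.span {A, B, C} = {cscale a A + cscale b B + cscale c C | a b c. True}"
  unfolding cmat.span_insert cmat.span_empty by (simp add: algebra_simps eq_diff_eq)

lemma type_A_normal_form_eq:
  "type_A_normal_form c g = {normal_mat c (3 * g) q b t | q b t. True}"
proof -
  have *: "cscale a (conic 0 1 0 0 1 0) + cscale b (conic 0 0 0 0 0 1) +
      cscale t (conic (- 1) (- 2 * g) c 0 g 0) = normal_mat c (3 * g) (a - 2 * g * t) b t" for a b t
    by (simp add: matrix_eq_3 normal_mat_def algebra_simps)
  have "normal_mat c (3 * g) q b t = normal_mat c (3 * g) (q + 2 * g * t - 2 * g * t) b t" for q b t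
    by simp
  then show ?thesis
    unfolding type_A_normal_form_def span_3 * by blast
qed

lemma normal_mat_inject:
  "normal_mat c k q b t = normal_mat c k q' b' t' \<longleftrightarrow> q = q' \<and> b = b' \<and> t = t'"
  by (auto simp: normal_mat_def matrix_eq_3)

lemma det_normal_mat: "det (normal_mat c k q b t) = cubic k (c + k^2) q b t"
  by (simp add: det_3 normal_mat_def cubic_def algebra_simps eval_nat_numeral)

lemma matrix_inv_normal_mat:
  assumes "cubic k (c + k^2) q b t \<noteq> 0"
  shows "matrix_inv (normal_mat c k q b t) = cscale (1 / cubic k (c + k^2) q b t) (normal_adj c k q b t)"
proof (rule matrix_inv_eqI)
  define D where "D = cubic k (c + k^2) q b t"
  have "normal_mat c k q b t ** normal_adj c k q b t = cscale D (mat 1)"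
    by (simp add: matrix_eq_3 mult_nth_3 normal_mat_def normal_adj_def mat_def D_def cubic_def
        algebra_simps eval_nat_numeral)
  moreover have "D \<noteq> 0" using assms by (simp add: D_def)
  moreover have "normal_mat c k q b t ** cscale (1 / D) A = cscale (1 / D) (normal_mat c k q b t ** A)" for A
    by (simp add: vec_eq_iff mult_nth_3 algebra_simps)
  ultimately show "normal_mat c k q b t ** cscale (1 / D) (normal_adj c k q b t) = mat 1"
    by (simp add: vec_eq_iff)
qed

text \<open>Jacobi's formula: pairing the adjugate with a direction differentiates the determinant,
  so the coefficients of \<open>q'\<close>, \<open>b'\<close>, \<open>t'\<close> are the partial
  derivatives of \<open>cubic\<close>.\<close>

lemma trace_normal_adj:
  "trace (cscale r (normal_adj c k q b t) ** normal_mat c k q' b' t') =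
     r * ((- 3 * q^2 - 4 * k * q * t - (c + k^2) * t^2) * q' + 2 * t * b * b' +
       (b^2 - 2 * k * q^2 - 2 * (c + k^2) * q * t) * t')"
  by (simp add: trace_3 mult_nth_3 normal_mat_def normal_adj_def algebra_simps eval_nat_numeral)

lemma trace_normal_mat:
  assumes "S \<in> Sym3"
  shows "trace (S ** normal_mat c k q b t) =
    (S$2$2 + 2 * S$1$3) * q + 2 * S$2$3 * b + (2 * k * S$1$3 + c * S$3$3 - S$1$1) * t"
  using Sym3_nth_commute[OF assms, of 3 1] Sym3_nth_commute[OF assms, of 3 2]
  by (simp add: trace_3 mult_nth_3 normal_mat_def algebra_simps)

lemma linear_form_eq_iff:
  fixes a b c a' b' c' :: complex
  shows "(\<forall>x y z. a * x + b * y + c * z = a' * x + b' * y + c' * z) \<longleftrightarrow> a = a' \<and> b = b' \<and> c = c'"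
proof
  assume *: "\<forall>x y z. a * x + b * y + c * z = a' * x + b' * y + c' * z"
  show "a = a' \<and> b = b' \<and> c = c'"
    using *[rule_format, of 1 0 0] *[rule_format, of 0 1 0] *[rule_format, of 0 0 1] by simp
qed simp

text \<open>Criticality equates two linear forms on the net, the differential of log det and the
  pairing with \<open>S\<close>. Comparing coefficients gives the equations of
  \<open>polar_fibre\<close>.\<close>

lemma critical_points_normal_form:
  assumes S: "S \<in> Sym3"
  shows "critical_points (type_A_normal_form c g) S =
    (\<lambda>(q, b, t). normal_mat c (3 * g) q b t) ` polar_fibre (3 * g) (c + (3 * g)^2)
      (S$2$2 + 2 * S$1$3) (2 * S$2$3) (2 * (3 * g) * S$1$3 + c * S$3$3 - S$1$1)"
proof -
  define k e where "k = 3 * g" and "e = c + k^2"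
  define u v w where "u = S$2$2 + 2 * S$1$3" and "v = 2 * S$2$3"
    and "w = 2 * k * S$1$3 + c * S$3$3 - S$1$1"
  have crit: "normal_mat c k q b t \<in> critical_points (type_A_normal_form c g) S \<longleftrightarrow>
      (q, b, t) \<in> polar_fibre k e u v w" for q b t
  proof (cases "cubic k e q b t = 0")
    case True
    then show ?thesis
      by (simp add: critical_points_def polar_fibre_def invertible_det_nz det_normal_mat e_def)
  next
    case False
    define D where "D = cubic k e q b t"
    have "D \<noteq> 0" using False by (simp add: D_def)
    have inv: "matrix_inv (normal_mat c k q b t) = cscale (1 / D) (normal_adj c k q b t)"
      using matrix_inv_normal_mat False unfolding D_def e_def by blast
    have "normal_mat c k q b t \<in> critical_points (type_A_normal_form c g) S \<longleftrightarrow>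
        (\<forall>q' b' t'. trace (cscale (1 / D) (normal_adj c k q b t) ** normal_mat c k q' b' t') =
           trace (S ** normal_mat c k q' b' t'))"
      using False unfolding critical_points_def type_A_normal_form_eq k_def[symmetric] mem_Collect_eq inv
      by (auto simp: invertible_det_nz det_normal_mat e_def inv)
    also have "\<dots> \<longleftrightarrow> (\<forall>q' b' t'.
        ((- 3 * q^2 - 4 * k * q * t - e * t^2) / D) * q' + (2 * t * b / D) * b' +
           ((b^2 - 2 * k * q^2 - 2 * e * q * t) / D) * t' = u * q' + v * b' + w * t')"
      unfolding trace_normal_adj trace_normal_mat[OF S] e_def u_def v_def w_def
      by (simp add: add_divide_distrib distrib_left distrib_right mult.assoc)
    also have "\<dots> \<longleftrightarrow> (q, b, t) \<in> polar_fibre k e u v w"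
      using \<open>D \<noteq> 0\<close> unfolding linear_form_eq_iff polar_fibre_def D_def by (simp add: divide_eq_eq)
    finally show ?thesis .
  qed
  have "critical_points (type_A_normal_form c g) S =
      (\<lambda>(q, b, t). normal_mat c k q b t) ` polar_fibre k e u v w"
  proof (intro equalityI subsetI)
    fix M assume M: "M \<in> critical_points (type_A_normal_form c g) S"
    then obtain q b t where qbt: "M = normal_mat c k q b t"
      unfolding critical_points_def type_A_normal_form_eq k_def by blast
    show "M \<in> (\<lambda>(q, b, t). normal_mat c k q b t) ` polar_fibre k e u v w"
      using M crit[of q b t] unfolding qbt by (intro image_eqI[of _ _ "(q, b, t)"]) simp_all
  qed (use crit in auto)
  then show ?thesis
    by (simp only: k_def e_def u_def v_def w_def)
qed

lemma type_A_normal_form_ml_degree: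
  assumes "c \<noteq> 0" "c \<noteq> - 9 * g^2"
  shows "has_ml_degree (type_A_normal_form c g) 4"
proof -
  define k e where "k = 3 * g" and "e = c + k^2"
  \<comment> \<open>These are c \<noteq> - 9 g^2 and c \<noteq> 0 in the new parameters.\<close>
  have e: "e \<noteq> 0" "e \<noteq> k^2"
    using assms by (auto simp: e_def k_def power2_eq_square add_eq_0_iff2)
  define u v w where "u S = S$2$2 + 2 * S$1$3" and "v S = 2 * S$2$3"
    and "w S = 2 * k * S$1$3 + c * S$3$3 - S$1$1" for S :: cmat
  have uvw: "polynomial_fun u" "polynomial_fun v" "polynomial_fun w"
    unfolding u_def v_def w_def by (intro polynomial_fun_intros)+
  \<comment> \<open>A section of the linear map sending \<open>S\<close> to (u, v, w): a single good
    value of (u, v, w) lifts to a symmetric matrix witnessing genericity.\<close>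
  define T where "T x y z = conic (- z) x 0 0 0 (y / 2)" for x y z
  have T: "u (T x y z) = x" "v (T x y z) = y" "w (T x y z) = z" "T x y z \<in> Sym3" for x y z
    by (simp_all add: u_def v_def w_def T_def)
  obtain x where x: "fibre_disc k e x 1 0 \<noteq> 0" using fibre_disc_nonzero[OF e] by blast
  obtain z where z: "fibre_resultant k e 0 1 z \<noteq> 0" using fibre_resultant_nonzero by blast
  have "for_generic (\<lambda>S. u S \<noteq> 0)" "for_generic (\<lambda>S. v S \<noteq> 0)"
    by (rule for_generic_nonzero[OF _ T(4)[of 1 1 0]]; simp add: uvw T)+
  moreover have "for_generic (\<lambda>S. fibre_disc k e (u S) (v S) (w S) \<noteq> 0)"
  proof (rule for_generic_nonzero[of _ "T x 1 0"])
    show "polynomial_fun (\<lambda>S. fibre_disc k e (u S) (v S) (w S))"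
      unfolding fibre_disc_def quartic_disc_def by (intro polynomial_fun_intros uvw)
  qed (simp_all add: T x)
  moreover have "for_generic (\<lambda>S. fibre_resultant k e (u S) (v S) (w S) \<noteq> 0)"
  proof (rule for_generic_nonzero[of _ "T 0 1 z"])
    show "polynomial_fun (\<lambda>S. fibre_resultant k e (u S) (v S) (w S))"
      unfolding fibre_resultant_def quadratic_resultant_def by (intro polynomial_fun_intros uvw)
  qed (simp_all add: T z)
  ultimately have "for_generic (\<lambda>S. (u S \<noteq> 0 \<and> v S \<noteq> 0) \<and>
      (fibre_disc k e (u S) (v S) (w S) \<noteq> 0 \<and> fibre_resultant k e (u S) (v S) (w S) \<noteq> 0))"
    by (intro for_generic_both)
  then show ?thesis
    unfolding has_ml_degree_def
  proof (rule for_generic_mono)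
    fix S :: cmat
    assume S: "S \<in> Sym3" and *: "(u S \<noteq> 0 \<and> v S \<noteq> 0) \<and>
      (fibre_disc k e (u S) (v S) (w S) \<noteq> 0 \<and> fibre_resultant k e (u S) (v S) (w S) \<noteq> 0)"
    have "inj (\<lambda>(q, b, t). normal_mat c k q b t)"
      by (auto simp: inj_def normal_mat_inject)
    then have "inj_on (\<lambda>(q, b, t). normal_mat c k q b t) (polar_fibre k e (u S) (v S) (w S))"
      by (rule inj_on_subset) simp
    moreover have "critical_points (type_A_normal_form c g) S =
        (\<lambda>(q, b, t). normal_mat c k q b t) ` polar_fibre k e (u S) (v S) (w S)"
      using critical_points_normal_form[OF S] by (simp add: u_def v_def w_def e_def k_def)
    ultimately show "finite (critical_points (type_A_normal_form c g) S) \<and>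
        card (critical_points (type_A_normal_form c g) S) = 4"
      using polar_fibre_card[OF e] * by (simp add: card_image)
  qed
qed

section \<open>Quadrics through the reciprocal surface and the polar net\<close>

text \<open>On \<^const>\<open>normal_adj\<close> the local functions take the values of the monomials they are named after,
  except that \<open>tt\<close> is \<open>c + k\<^sup>2\<close> times the square of \<open>t\<close>.\<close>

definition veronese_quadrics :: "complex \<Rightarrow> complex \<Rightarrow> (cmat \<Rightarrow> complex) set" where
  "veronese_quadrics c k =
    (let qt = (\<lambda>A. - 1 * A$3$3);
         bt = (\<lambda>A. A$2$3);
         bb = (\<lambda>A. - c * A$3$3 - A$1$1);
         qb = (\<lambda>A. A$1$2 - k * A$2$3);
         qq = (\<lambda>A. k * A$3$3 - A$1$3);
         tt = (\<lambda>A. k * A$3$3 + A$1$3 - A$2$2)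
     in {\<lambda>A. qq A * bb A - qb A * qb A,
         \<lambda>A. qq A * tt A - (c + k^2) * (qt A * qt A),
         \<lambda>A. bb A * tt A - (c + k^2) * (bt A * bt A)})"

lemma veronese_quadrics_homogeneous:
  assumes "p \<in> veronese_quadrics c k"
  shows "homogeneous_poly (1 + 1) p"
  using assms unfolding veronese_quadrics_def Let_def
  by (elim insertE emptyE; simp only:)
    (intro homogeneous_poly_diff homogeneous_poly_cmult hom_mult hom_add hom_entry)+

lemma veronese_quadrics_normal_adj:
  assumes "p \<in> veronese_quadrics c k"
  shows "p (cscale r (normal_adj c k q b t)) = 0"
proof -
  have "p (normal_adj c k q b t) = 0"
    using assms unfolding veronese_quadrics_def Let_def normal_adj_def
    by (auto simp: power2_eq_square algebra_simps)
  then show ?thesis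
    by (simp add: homogeneous_poly_scale[OF veronese_quadrics_homogeneous[OF assms]])
qed

text \<open>Being polar to the net is the vanishing of the three partial derivatives of the cubic,
  read as linear forms in the monomials. With the quadrics this leaves only zero, by the two
  conditions on \<open>c\<close> and \<open>k\<close> that make the cubic smooth.\<close>

lemma veronese_quadrics_polar:
  assumes c: "c \<noteq> 0" "c + k^2 \<noteq> 0"
    and N: "N \<in> Sym3" "\<And>q b t. trace (N ** normal_mat c k q b t) = 0"
    and p: "\<And>p. p \<in> veronese_quadrics c k \<Longrightarrow> p N = 0"
  shows "N = 0"
proof -
  \<comment> \<open>The values at \<open>N\<close> of \<open>qq\<close> and \<open>qt\<close> from
    \<open>veronese_quadrics\<close>.\<close>
  define X Z where "X = k * N$3$3 - N$1$3" and "Z = - N$3$3"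
  have N0: "N$2$2 + 2 * N$1$3 = 0" "N$2$3 = 0" "2 * k * N$1$3 + c * N$3$3 - N$1$1 = 0"
    using N(2)[of 1 0 0] N(2)[of 0 1 0] N(2)[of 0 0 1] by (simp_all add: trace_normal_mat[OF N(1)])
  have p': "\<forall>p\<in>veronese_quadrics c k. p N = 0"
    using p by blast
  have p0: "(k * N$3$3 - N$1$3) * (- c * N$3$3 - N$1$1) - (N$1$2 - k * N$2$3) * (N$1$2 - k * N$2$3) = 0"
    "(k * N$3$3 - N$1$3) * (k * N$3$3 + N$1$3 - N$2$2) - (c + k^2) * (N$3$3 * N$3$3) = 0"
    "(- c * N$3$3 - N$1$1) * (k * N$3$3 + N$1$3 - N$2$2) - (c + k^2) * (N$2$3 * N$2$3) = 0"
    using p' by (simp_all add: veronese_quadrics_def)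
  \<comment> \<open>On the polar net \<open>bt\<close> becomes 0, \<open>tt\<close> becomes - (3 X +
    4 k Z) and \<open>bb\<close> becomes 2 (k X + (c + k^2) Z). The last two are the factors in the
    case split below.\<close>
  have n: "N$3$3 = - Z" "N$1$3 = - X - k * Z" "N$2$2 = 2 * X + 2 * k * Z" "N$2$3 = 0"
    "N$1$1 = - c * Z - 2 * k * X - 2 * k^2 * Z"
    using N0 unfolding X_def Z_def by algebra+
  have 2: "3 * X^2 + 4 * k * X * Z + (c + k^2) * Z^2 = 0"
    using p0(2) unfolding n by algebra
  have "2 * ((k * X + (c + k^2) * Z) * (3 * X + 4 * k * Z)) = 0"
    using p0(3) unfolding n by algebra
  then have 3: "k * X + (c + k^2) * Z = 0 \<or> 3 * X + 4 * k * Z = 0" by simp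
  have "Z = 0"
    using 3
  proof
    assume *: "k * X + (c + k^2) * Z = 0"
    have "3 * X * (X + k * Z) = 0" using 2 * by algebra
    then consider "X = 0" | "X + k * Z = 0" by auto
    then show ?thesis
    proof cases
      case 2
      then have "c * Z = 0" using * by algebra
      then show ?thesis using c by simp
    qed (use * c in simp)
  next
    assume "3 * X + 4 * k * Z = 0"
    then have "(c + k^2) * Z^2 = 0" using 2 by algebra
    then show ?thesis using c by simp
  qed
  moreover from this 2 have "X = 0" by simp
  moreover have "N$1$2 = 0" using p0(1) calculation by (simp add: n)
  ultimately show ?thesis
    by (subst Sym3_eq_conic[OF N(1)]) (simp add: n matrix_eq_3)
qed

section \<open>Transport to an arbitrary net of type A\<close>

theorem proposition4p6:
  fixes L :: "(complex ^ 3 ^ 3) set"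
  assumes "net_of_conics L" and "type_A L"
  shows "ml_base_locus L = {} \<and> has_ml_degree L 4"
proof
  obtain c g h where c: "c \<noteq> 0" "c \<noteq> - 9 * g^2" and h: "invertible h"
    and L: "L = (\<lambda>M. transpose h ** M ** h) ` type_A_normal_form c g"
    using assms(2) by (auto simp: type_A_def congruent_nets_def)
  define k where "k = 3 * g"
  have e: "c + k^2 \<noteq> 0" using c by (auto simp: k_def power2_eq_square add_eq_0_iff2)
  have elem: "transpose h ** normal_mat c k q b t ** h \<in> L" for q b t
    unfolding L type_A_normal_form_eq k_def by blast
  show "ml_base_locus L = {}"
  \<comment> \<open>The quadrics are pulled back along A \<mapsto> h A h^T, the map that carries
    inverses of elements of \<open>L\<close> to inverses of elements of the normal form.\<close>
  proof (rule ml_base_locus_eq_empty[where F = "(\<lambda>p A. p (h ** A ** transpose h)) ` veronese_quadrics c k"])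
    show "L \<subseteq> Sym3" using assms(1) by (simp add: net_of_conics_def)
  next
    fix p assume "p \<in> (\<lambda>p A. p (h ** A ** transpose h)) ` veronese_quadrics c k"
    then show "\<exists>d. homogeneous_poly d p"
      using veronese_quadrics_homogeneous homogeneous_poly_congruence by blast
  next
    fix M p
    assume M: "M \<in> L" "det M \<noteq> 0" and p: "p \<in> (\<lambda>p A. p (h ** A ** transpose h)) ` veronese_quadrics c k"
    obtain q b t where M_eq: "M = transpose h ** normal_mat c k q b t ** h"
      using M(1) unfolding L type_A_normal_form_eq k_def by blast
    obtain p' where p': "p' \<in> veronese_quadrics c k" "p = (\<lambda>A. p' (h ** A ** transpose h))"
      using p by blast
    have inv: "invertible (normal_mat c k q b t)"
      using M(2) invertible_congruence_iff[OF h] unfolding M_eq by (simp add: invertible_det_nz)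
    then have "cubic k (c + k^2) q b t \<noteq> 0"
      by (simp add: invertible_det_nz det_normal_mat)
    then show "p (matrix_inv M) = 0"
      unfolding p'(2) M_eq matrix_inv_congruence[OF h inv]
      by (simp add: matrix_inv_normal_mat veronese_quadrics_normal_adj[OF p'(1)])
  next
    fix N
    assume N: "N \<in> polar_net L"
      and p: "\<And>p. p \<in> (\<lambda>p A. p (h ** A ** transpose h)) ` veronese_quadrics c k \<Longrightarrow> p N = 0"
    \<comment> \<open>The trace pairing is preserved by the two opposite congruences, so this matrix
      is polar to the normal form.\<close>
    have "h ** N ** transpose h = 0"
    proof (rule veronese_quadrics_polar[OF c(1) e])
      show "h ** N ** transpose h \<in> Sym3"
        using N Sym3_congruence by (simp add: polar_net_def)
      show "trace (h ** N ** transpose h ** normal_mat c k q b t) = 0" for q b t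
        using N elem[of q b t] unfolding trace_congruence[symmetric] polar_net_def
        by (auto simp: trace_mul_sym[of N])
    qed (use p in blast)
    then have "h ** N ** transpose h = h ** 0 ** transpose h" by simp
    then show "N = 0"
      unfolding invertible_mult_cancel(2)[OF invertible_transpose[OF h]] invertible_mult_cancel(1)[OF h] .
  qed
  show "has_ml_degree L 4"
    unfolding has_ml_degree_def
  proof (rule for_generic_mono)
    show "for_generic (\<lambda>S. finite (critical_points (type_A_normal_form c g) (h ** S ** transpose h)) \<and>
        card (critical_points (type_A_normal_form c g) (h ** S ** transpose h)) = 4)"
      using for_generic_congruence[OF h] type_A_normal_form_ml_degree[OF c]
      unfolding has_ml_degree_def by blast
  next
    fix S
    assume "finite (critical_points (type_A_normal_form c g) (h ** S ** transpose h)) \<and>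
        card (critical_points (type_A_normal_form c g) (h ** S ** transpose h)) = 4"
    moreover have "inj (\<lambda>M. transpose h ** M ** h)"
      by (rule injI) (simp add: invertible_mult_cancel h invertible_transpose)
    ultimately show "finite (critical_points L S) \<and> card (critical_points L S) = 4"
      unfolding L critical_points_congruence[OF h]
      by (auto simp: card_image inj_on_subset)
  qed
qed

end
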